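(* For any infinite cardinal $\theta$, the measure algebra $\mathscr{B}_\theta$ adding $\theta$-many random reals is $\theta$-intersection-linked. In particular, random forcing is $\sigma$-intersection-linked.
   Context: For a set $I$, give ${}^{I}2$ the product topology of the discrete space $\{0,1\}$, with basic clopen sets $[s] = \{x \in {}^{I}2 \colon s \subseteq x\}$ for $s$ a finite partial function from $I$ to $2$. Let $\mathcal{B}a({}^{I}2)$ be the $\sigma$-algebra of Baire sets, i.e. the $\sigma$-algebra generated by the clopen sets, let $\mathrm{Leb}^{I}$ be the product measure on it, where $\{0,1\}$ carries the measure giving $\{0\}$ and $\{1\}$ measure $\frac12$ each, and let $\mathcal{N}({}^{I}2)$ be the ideal of $\mathrm{Leb}^{I}$-null sets in $\mathcal{B}a({}^{I}2)$. For an infinite cardinal $\theta$, $\mathscr{B}_\theta := \mathcal{B}a({}^{\theta}2)/\mathcal{N}({}^{\theta}2)$. Random forcing is the complete Boolean algebra $\mathcal{B}({}^{\omega}2)/\mathcal{N}({}^{\omega}2)$, Borel subsets of ${}^{\omega}2$ modulo Lebesgue-null sets. A Boolean algebra $\mathscr{B}$ is viewed as a forcing notion (preordered set) by taking $\mathscr{B}^{+}=\mathscr{B} \setminus \{0_{\mathscr{B}}\}$ with the order of $\mathscr{B}$ (so lower bounds are nonzero). For a forcing notion $\mathbb{P}$ and $\bar{q} = \langle q_i \colon i < n\rangle \in {}^{n}\mathbb{P}$, let $i_{\ast}^{\mathbb{P}}(\bar{q}) := \max\{ |F| \colon F \subseteq n=\{0,\dots,n-1\} \text{ and } \{q_i \colon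 i \in F\} \text{ has a lower bound in } \mathbb{P}\}$, and for $Q \subseteq \mathbb{P}$ let $\mathrm{int}^{\mathbb{P}}(Q) := \inf\{ i_{\ast}^{\mathbb{P}}(\bar{q})/n \colon \bar{q} \in {}^{n}Q,\ n \in \omega \setminus \{0\}\}$ (with $\inf\emptyset = +\infty$). For an infinite cardinal $\theta$, a forcing notion $\mathbb{P}$ is $\theta$-intersection-linked if there is a family $\langle Q_{\alpha,\varepsilon} \colon \alpha < \theta,\ \varepsilon \in (0,1) \cap \mathbb{Q}\rangle$ of subsets of $\mathbb{P}$ (here $\mathbb{Q}$ denotes the rationals) such that: (1) $\mathrm{int}^{\mathbb{P}}(Q_{\alpha,\varepsilon}) \geq 1 - \varepsilon$ for all $\alpha<\theta$ and all $\varepsilon$; (2) $\bigcup_{\alpha<\theta} Q_{\alpha,\varepsilon}$ is dense in $\mathbb{P}$ for every $\varepsilon$. "$\sigma$-intersection-linked" means $\aleph_0$-intersection-linked. *)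

theory Defs
  imports "HOL-Probability.Probability" "HOL-Algebra.Order"
begin

text \<open>The set \<open>2 = {0, 1}\<close> is rendered as \<^typ>\<open>bool\<close>, and the points of
  \<open>{}\<^sup>I2\<close> are the functions in \<open>I \<rightarrow>\<^sub>E UNIV\<close>.\<close>

definition cantor_space :: "'i set \<Rightarrow> ('i \<Rightarrow> bool) topology" where
  "cantor_space I = product_topology (\<lambda>_. discrete_topology UNIV) I"

definition Baire_sets :: "'i set \<Rightarrow> ('i \<Rightarrow> bool) set set" where
  "Baire_sets I = sigma_sets (topspace (cantor_space I))
     {C. openin (cantor_space I) C \<and> closedin (cantor_space I) C}"

definition Borel_sets :: "'i set \<Rightarrow> ('i \<Rightarrow> bool) set set" where
  "Borel_sets I = sigma_sets (topspace (cantor_space I)) {U. openin (cantor_space I) U}"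

definition Leb :: "'i set \<Rightarrow> ('i \<Rightarrow> bool) measure" where
  "Leb I = Pi\<^sub>M I (\<lambda>_. uniform_count_measure UNIV)"

lemma topspace_cantor_space: "topspace (cantor_space I) = I \<rightarrow>\<^sub>E UNIV"
  by (simp add: cantor_space_def)

lemma space_Leb: "space (Leb I) = I \<rightarrow>\<^sub>E UNIV"
  by (simp add: Leb_def space_PiM space_uniform_count_measure)

lemma sets_Leb: "sets (Leb I) = Baire_sets I"
proof (rule antisym)
  let ?X = "I \<rightarrow>\<^sub>E (UNIV :: bool set)"
  have eq: "sets (Leb I) = sigma_sets ?X {{f \<in> ?X. f i \<in> A} | i A. i \<in> I \<and> A \<in> UNIV}"
    unfolding Leb_def by (subst sets_PiM_single) (simp add: space_uniform_count_measure sets_uniform_count_measure)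
  have clopen: "openin (cantor_space I) {f \<in> ?X. f i \<in> A} \<and> closedin (cantor_space I) {f \<in> ?X. f i \<in> A}"
    if "i \<in> I" for i and A :: "bool set"
  proof -
    have c: "continuous_map (cantor_space I) (discrete_topology UNIV) (\<lambda>f. f i)"
      unfolding cantor_space_def using continuous_map_product_projection[OF that] .
    show ?thesis
      using openin_continuous_map_preimage[OF c, of A] closedin_continuous_map_preimage[OF c, of A]
      by (simp add: topspace_cantor_space)
  qed
  show "sets (Leb I) \<subseteq> Baire_sets I"
    unfolding eq Baire_sets_def topspace_cantor_space
    by (rule sigma_sets_mono') (use clopen in blast)
  have "C \<in> sets (Leb I)" if op: "openin (cantor_space I) C" and cl: "closedin (cantor_space I) C" for C
  proof -
    have "compact_space (cantor_space I)"
      unfolding cantor_space_def compact_space_product_topology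
      by (simp add: compact_space_discrete_topology)
    then have comp: "compactin (cantor_space I) C"
      using cl closedin_compact_space by blast
    define basic where "basic U \<longleftrightarrow> (\<exists>X. U = PiE I X \<and> finite {i \<in> I. X i \<noteq> (UNIV :: bool set)})" for U
    have ex: "\<exists>X. finite {i \<in> I. X i \<noteq> UNIV} \<and> f \<in> PiE I X \<and> PiE I X \<subseteq> C" if "f \<in> C" for f
      using op that unfolding cantor_space_def openin_product_topology_alt topspace_discrete_topology
      by meson
    have basic_ex: "\<exists>U. basic U \<and> f \<in> U \<and> U \<subseteq> C" if f: "f \<in> C" for f
    proof -
      obtain X where X: "finite {i \<in> I. X i \<noteq> UNIV}" "f \<in> PiE I X" "PiE I X \<subseteq> C"
        using ex[OF f] by auto
      show ?thesis by (rule exI[of _ "PiE I X"]) (use X in \<open>simp add: basic_def, metis\<close>)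
    qed
    have basic_open: "openin (cantor_space I) U" if U: "basic U" for U
    proof -
      obtain X where X: "U = PiE I X" "finite {i \<in> I. X i \<noteq> (UNIV :: bool set)}"
        using U unfolding basic_def by (elim exE conjE)
      show ?thesis unfolding X(1) cantor_space_def openin_PiE_gen using X(2) by simp
    qed
    have basic_sets: "U \<in> sets (Leb I)" if U: "basic U" for U
    proof -
      obtain X where X: "U = PiE I X" "finite {i \<in> I. X i \<noteq> (UNIV :: bool set)}"
        using U unfolding basic_def by (elim exE conjE)
      let ?J = "{i \<in> I. X i \<noteq> UNIV}"
      have "prod_emb I (\<lambda>_. uniform_count_measure UNIV) ?J (PiE ?J X) =
              (\<Pi>\<^sub>E i\<in>I. if i \<in> ?J then X i else space (uniform_count_measure UNIV))"
        by (rule prod_emb_PiE) (auto simp: space_uniform_count_measure)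
      also have "\<dots> = U"
        unfolding X(1) by (rule PiE_cong) (simp add: space_uniform_count_measure)
      finally have "U = prod_emb I (\<lambda>_. uniform_count_measure UNIV) ?J (PiE ?J X)" ..
      also have "\<dots> \<in> sets (Leb I)"
        unfolding Leb_def using X(2) by (intro sets_PiM_I) (auto simp: sets_uniform_count_measure)
      finally show ?thesis .
    qed
    define \<U> where "\<U> = {U. basic U \<and> U \<subseteq> C}"
    have cover: "C \<subseteq> \<Union>\<U>"
    proof
      fix f assume "f \<in> C"
      then show "f \<in> \<Union>\<U>" using basic_ex[of f] unfolding \<U>_def by blast
    qed
    have op\<U>: "\<And>U. U \<in> \<U> \<Longrightarrow> openin (cantor_space I) U"
      using basic_open by (simp add: \<U>_def)
    from compactinD[OF comp op\<U> cover, simplified]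
    obtain \<F> where F: "finite \<F>" "\<F> \<subseteq> \<U>" "C \<subseteq> \<Union>\<F>" by (elim exE conjE)
    have "\<Union>\<F> \<subseteq> C" using F(2) unfolding \<U>_def by blast
    with F(3) have C: "C = \<Union>\<F>" by (rule equalityI)
    have "\<F> \<subseteq> sets (Leb I)" using F(2) basic_sets unfolding \<U>_def by blast
    with F(1) have "\<Union>\<F> \<in> sets (Leb I)" by (rule sets.finite_Union)
    then show ?thesis unfolding C .
  qed
  then show "Baire_sets I \<subseteq> sets (Leb I)"
    unfolding Baire_sets_def topspace_cantor_space space_Leb[symmetric]
    by (intro sets.sigma_sets_subset subsetI) simp
qed

lemma Borel_sets_nat: "Borel_sets (UNIV :: nat set) = sets (Leb UNIV)"
proof (rule antisym)
  define cyl where "cyl xs = {f :: nat \<Rightarrow> bool. \<forall>i<length xs. f i = xs ! i}" for xs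
  have cyl_sets: "cyl xs \<in> sets (Leb UNIV)" for xs
  proof -
    have "cyl xs = prod_emb UNIV (\<lambda>_. uniform_count_measure UNIV) {..<length xs}
                     (PiE {..<length xs} (\<lambda>i. {xs ! i}))"
      by (subst prod_emb_PiE) (auto simp: cyl_def PiE_def Pi_def space_uniform_count_measure)
    also have "\<dots> \<in> sets (Leb UNIV)"
      unfolding Leb_def by (intro sets_PiM_I) (auto simp: sets_uniform_count_measure)
    finally show ?thesis .
  qed
  have "U \<in> sets (Leb UNIV)" if op: "openin (cantor_space UNIV) U" for U :: "(nat \<Rightarrow> bool) set"
  proof -
    have "\<exists>xs. f \<in> cyl xs \<and> cyl xs \<subseteq> U" if "f \<in> U" for f
    proof -
      have "\<exists>X. finite {i \<in> UNIV. X i \<noteq> UNIV} \<and> f \<in> PiE UNIV X \<and> PiE UNIV X \<subseteq> U"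
        using op that unfolding cantor_space_def openin_product_topology_alt topspace_discrete_topology
        by meson
      then obtain X where X: "finite {i. X i \<noteq> UNIV}" "f \<in> PiE UNIV X" "PiE UNIV X \<subseteq> U"
        by auto
      obtain n where n: "{i. X i \<noteq> UNIV} \<subseteq> {..<n}"
        using X(1) finite_nat_iff_bounded by blast
      have "cyl (map f [0..<n]) \<subseteq> PiE UNIV X"
      proof
        fix g assume "g \<in> cyl (map f [0..<n])"
        then have g: "g i = f i" if "i < n" for i using that by (simp add: cyl_def)
        have "g i \<in> X i" for i
          using g[of i] n X(2) by (cases "i < n") (auto simp: PiE_iff)
        then show "g \<in> PiE UNIV X" by (simp add: PiE_iff)
      qed
      with X(3) have "f \<in> cyl (map f [0..<n]) \<and> cyl (map f [0..<n]) \<subseteq> U"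
        by (auto simp: cyl_def)
      then show ?thesis by blast
    qed
    then have U: "U = \<Union> (cyl ` {xs. cyl xs \<subseteq> U})" by blast
    show ?thesis
      by (subst U, rule sets.countable_UN'') (auto simp: cyl_sets)
  qed
  then show "Borel_sets (UNIV :: nat set) \<subseteq> sets (Leb UNIV)"
    unfolding Borel_sets_def topspace_cantor_space space_Leb[symmetric]
    by (intro sets.sigma_sets_subset subsetI) simp
  show "sets (Leb UNIV) \<subseteq> Borel_sets (UNIV :: nat set)"
    unfolding sets_Leb Baire_sets_def Borel_sets_def by (rule sigma_sets_mono') blast
qed

text \<open>The Boolean algebra \<open>\<A>/\<N>\<close> of a field of sets modulo an ideal, as an ordered set of
  equivalence classes; its order is that induced by the set operations,
  \<open>[A] \<le> [B] \<longleftrightarrow> [A \<inter> B] = [A] \<longleftrightarrow> A - B \<in> \<N>\<close>.\<close>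

definition mod_ideal :: "'a set set \<Rightarrow> 'a set set \<Rightarrow> ('a set \<times> 'a set) set" where
  "mod_ideal \<A> \<N> = {(A, B). A \<in> \<A> \<and> B \<in> \<A> \<and> (A - B) \<union> (B - A) \<in> \<N>}"

definition quotient_algebra :: "'a set set \<Rightarrow> 'a set set \<Rightarrow> 'a set set gorder" where
  "quotient_algebra \<A> \<N> =
    \<lparr>carrier = \<A> // mod_ideal \<A> \<N>, eq = (=), le = (\<lambda>a b. \<exists>A\<in>a. \<exists>B\<in>b. A - B \<in> \<N>)\<rparr>"

definition measure_algebra :: "'i set \<Rightarrow> ('i \<Rightarrow> bool) set set gorder" where
  "measure_algebra I = quotient_algebra (Baire_sets I) (Baire_sets I \<inter> null_sets (Leb I))"

definition random_algebra :: "(nat \<Rightarrow> bool) set set gorder" where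
  "random_algebra = quotient_algebra (Borel_sets UNIV) (Borel_sets UNIV \<inter> null_sets (Leb UNIV))"

lemma quotient_algebra_order:
  fixes M :: "'a measure"
  defines "L \<equiv> quotient_algebra (sets M) (null_sets M)"
    and "cls \<equiv> \<lambda>A. mod_ideal (sets M) (null_sets M) `` {A}"
  shows "carrier L = cls ` sets M"
    and "A \<in> sets M \<Longrightarrow> B \<in> sets M \<Longrightarrow> cls A \<sqsubseteq>\<^bsub>L\<^esub> cls B \<longleftrightarrow> A - B \<in> null_sets M"
    and "partial_order L"
    and "\<bottom>\<^bsub>L\<^esub> = null_sets M"
proof -
  show car: "carrier L = cls ` sets M"
    by (auto simp: L_def quotient_algebra_def cls_def quotient_def)
  have cls: "X \<in> cls A \<longleftrightarrow> A \<in> sets M \<and> X \<in> sets M \<and> A - X \<in> null_sets M \<and> X - A \<in> null_sets M"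
    for A X
  proof
    assume "X \<in> cls A"
    then have *: "A \<in> sets M" "X \<in> sets M" "(A - X) \<union> (X - A) \<in> null_sets M"
      by (auto simp: cls_def mod_ideal_def)
    show "A \<in> sets M \<and> X \<in> sets M \<and> A - X \<in> null_sets M \<and> X - A \<in> null_sets M"
      using * null_sets_subset[OF *(3), of "A - X"] null_sets_subset[OF *(3), of "X - A"] by auto
  qed (auto simp: cls_def mod_ideal_def)
  have tr: "A - C \<in> null_sets M"
    if "A - B \<in> null_sets M" "B - C \<in> null_sets M" "A \<in> sets M" "C \<in> sets M" for A B C
    by (rule null_sets_subset[OF null_sets.Un[OF that(1,2)]]) (use that in auto)
  have le: "cls A \<sqsubseteq>\<^bsub>L\<^esub> cls B \<longleftrightarrow> A - B \<in> null_sets M" if "A \<in> sets M" "B \<in> sets M" for A B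
  proof
    assume "cls A \<sqsubseteq>\<^bsub>L\<^esub> cls B"
    then obtain X Y where "X \<in> cls A" "Y \<in> cls B" "X - Y \<in> null_sets M"
      by (auto simp: L_def quotient_algebra_def)
    then show "A - B \<in> null_sets M"
      unfolding cls by (meson tr)
  next
    assume "A - B \<in> null_sets M"
    moreover have "A \<in> cls A" "B \<in> cls B" using that by (auto simp: cls)
    ultimately show "cls A \<sqsubseteq>\<^bsub>L\<^esub> cls B"
      by (auto simp: L_def quotient_algebra_def)
  qed
  then show "A \<in> sets M \<Longrightarrow> B \<in> sets M \<Longrightarrow> cls A \<sqsubseteq>\<^bsub>L\<^esub> cls B \<longleftrightarrow> A - B \<in> null_sets M" .
  have eq: "cls A = cls B"
    if "A \<in> sets M" "B \<in> sets M" "A - B \<in> null_sets M" "B - A \<in> null_sets M" for A B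
  proof (rule Set.set_eqI)
    fix X
    show "X \<in> cls A \<longleftrightarrow> X \<in> cls B"
      unfolding cls using that tr[of A B X] tr[of B A X] tr[of X A B] tr[of X B A] by blast
  qed
  have eqL: "(.=\<^bsub>L\<^esub>) = (=)" by (simp add: L_def quotient_algebra_def)
  show po: "partial_order L"
  proof unfold_locales
    fix x y z assume xyz: "x \<sqsubseteq>\<^bsub>L\<^esub> y" "y \<sqsubseteq>\<^bsub>L\<^esub> z" "x \<in> carrier L" "y \<in> carrier L" "z \<in> carrier L"
    then obtain A B C where ABC: "x = cls A" "y = cls B" "z = cls C"
      "A \<in> sets M" "B \<in> sets M" "C \<in> sets M"
      unfolding car by (elim imageE)
    show "x \<sqsubseteq>\<^bsub>L\<^esub> z"
      using xyz(1,2) ABC(4-6) tr[of A B C] unfolding ABC(1-3) by (simp add: le)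
  next
    fix x y assume xy: "x \<sqsubseteq>\<^bsub>L\<^esub> y" "y \<sqsubseteq>\<^bsub>L\<^esub> x" "x \<in> carrier L" "y \<in> carrier L"
    then obtain A B where AB: "x = cls A" "y = cls B" "A \<in> sets M" "B \<in> sets M"
      unfolding car by (elim imageE)
    show "x .=\<^bsub>L\<^esub> y"
      using xy(1,2) AB(3,4) eq[of A B] unfolding AB(1,2) eqL by (simp add: le)
  qed (simp_all add: eqL, auto simp: car le)
  interpret partial_order L by (rule po)
  have n: "cls {} = null_sets M" by (auto simp: cls)
  have l: "least L (cls {}) (carrier L)" by (auto simp: least_def car le)
  have "least L (\<bottom>\<^bsub>L\<^esub>) (carrier L)" unfolding bottom_def using l by (rule someI)
  with l n show "\<bottom>\<^bsub>L\<^esub> = null_sets M" using least_unique by metis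
qed

lemma measure_algebra_eq: "measure_algebra I = quotient_algebra (sets (Leb I)) (null_sets (Leb I))"
  unfolding measure_algebra_def sets_Leb[symmetric]
  by (rule arg_cong[of _ _ "quotient_algebra _"]) auto

lemma random_algebra_eq: "random_algebra = quotient_algebra (sets (Leb UNIV)) (null_sets (Leb UNIV))"
  unfolding random_algebra_def Borel_sets_nat
  by (rule arg_cong[of _ _ "quotient_algebra _"]) auto

text \<open>A Boolean algebra as a forcing notion: its zero element is removed.\<close>

definition forcing_of :: "'b gorder \<Rightarrow> 'b gorder" where
  "forcing_of L = L\<lparr>carrier := carrier L - {\<bottom>\<^bsub>L\<^esub>}\<rparr>"

definition dense_in :: "'p gorder \<Rightarrow> 'p set \<Rightarrow> bool" where
  "dense_in P D \<longleftrightarrow> D \<subseteq> carrier P \<and> (\<forall>p\<in>carrier P. \<exists>d\<in>D. d \<sqsubseteq>\<^bsub>P\<^esub> p)"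

text \<open>Lower bounds in \<open>P\<close> are the members of the library set \<^const>\<open>Lower\<close>.
  A sequence \<open>\<langle>q\<^sub>i : i < n\<rangle>\<close> is a function on \<open>{..<n}\<close>.\<close>

definition i_star :: "'p gorder \<Rightarrow> nat \<Rightarrow> (nat \<Rightarrow> 'p) \<Rightarrow> nat" where
  "i_star P n q = Max {card F | F. F \<subseteq> {..<n} \<and> Lower P (q ` F) \<noteq> {}}"

text \<open>The infimum is taken in \<^typ>\<open>ereal\<close>, so that it is \<open>\<infinity>\<close> for \<open>Q = {}\<close>.\<close>

definition int_number :: "'p gorder \<Rightarrow> 'p set \<Rightarrow> ereal" where
  "int_number P Q =
    Inf {ereal (real (i_star P n q) / real n) | n q. n \<noteq> 0 \<and> q \<in> {..<n} \<rightarrow>\<^sub>E Q}"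

text \<open>As in the library, an infinite cardinal is a well-order \<open>\<theta>\<close> with \<^term>\<open>Cinfinite \<theta>\<close>;
  the indices \<open>\<alpha> < \<theta>\<close> are the elements of \<^term>\<open>Field \<theta>\<close>, and \<open>\<aleph>\<^sub>0\<close> is \<^term>\<open>natLeq\<close>.\<close>

definition intersection_linked :: "'i rel \<Rightarrow> 'p gorder \<Rightarrow> bool" where
  "intersection_linked \<theta> P \<longleftrightarrow>
    (\<exists>Q :: 'i \<Rightarrow> rat \<Rightarrow> 'p set.
      (\<forall>\<alpha>\<in>Field \<theta>. \<forall>\<epsilon>\<in>{0<..<1}. Q \<alpha> \<epsilon> \<subseteq> carrier P \<and> int_number P (Q \<alpha> \<epsilon>) \<ge> ereal (1 - real_of_rat \<epsilon>)) \<and>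
      (\<forall>\<epsilon>\<in>{0<..<1}. dense_in P (\<Union>\<alpha>\<in>Field \<theta>. Q \<alpha> \<epsilon>)))"

abbreviation sigma_intersection_linked :: "'p gorder \<Rightarrow> bool" where
  "sigma_intersection_linked \<equiv> intersection_linked natLeq"

end

theory Submission
  imports Defs
begin

text \<open>The proof uses nothing about \<open>{}\<^sup>\<theta>2\<close> beyond two facts: its measure is finite, and its
  \<open>\<sigma>\<close>-algebra is generated by at most \<open>\<theta>\<close> many sets, one for each coordinate and each subset of
  \<open>2\<close>. Closing the generators under finite Boolean operations gives an algebra \<open>H\<close> of sets, still of
  size at most \<open>\<theta>\<close>. For \<open>C \<in> H\<close> of positive measure let \<open>Q\<^sub>C\<^sub>,\<^sub>\<epsilon>\<close> consist of the classes of the sets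
  that fill at least the fraction \<open>1 - \<epsilon>\<close> of \<open>C\<close>.

  These families cover the whole forcing: a set \<open>A\<close> of positive measure is approximated in measure
  by members of \<open>H\<close>, arbitrarily well, and a close enough approximation \<open>C\<close> is nearly filled by \<open>A\<close>
  (\<open>approximable_by_algebra\<close>, \<open>algebra_member_mostly_filled\<close>).

  Their intersection number is at least \<open>1 - \<epsilon>\<close> by averaging. If \<open>n\<close> sets each fill the fraction
  \<open>1 - \<epsilon>\<close> of \<open>C\<close>, then a point of \<open>C\<close> lies in \<open>(1 - \<epsilon>)n\<close> of them on average, so on a set of
  positive measure it lies in at least that many; as there are only finitely many subfamilies, one
  that large has an intersection of positive measure (\<open>sum_measure_le_overlap\<close>). The class of this
  intersection is the required lower bound.

  Random forcing is the case \<open>\<theta> = \<aleph>\<^sub>0\<close>, since Borel and Baire subsets of \<open>{}\<^sup>\<omega>2\<close> coincide.\<close>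

unbundle cardinal_syntax

section \<open>The algebra generated by a family of sets\<close>

text \<open>One operation, the complement of the union of two sets, yields all finite Boolean
  operations. The empty set is put in at the start, so that the algebra has a member even when \<open>G\<close>
  is empty. Building the algebra in countably many stages makes its cardinality easy to bound.\<close>

primrec algebra_stage :: "'a set \<Rightarrow> 'a set set \<Rightarrow> nat \<Rightarrow> 'a set set" where
  "algebra_stage X G 0 = insert {} G"
| "algebra_stage X G (Suc n) = algebra_stage X G n \<union>
     (\<lambda>(A, B). X - (A \<union> B)) ` (algebra_stage X G n \<times> algebra_stage X G n)"

definition generated_algebra :: "'a set \<Rightarrow> 'a set set \<Rightarrow> 'a set set" where
  "generated_algebra X G = (\<Union>n. algebra_stage X G n)"

lemma algebra_stage_mono: "m \<le> n \<Longrightarrow> algebra_stage X G m \<subseteq> algebra_stage X G n"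
  by (rule lift_Suc_mono_le) auto

lemma generated_algebra_empty: "{} \<in> generated_algebra X G"
  unfolding generated_algebra_def by (rule UN_I[of 0]) auto

lemma generated_algebra_base: "G \<subseteq> generated_algebra X G"
  unfolding generated_algebra_def by (rule subsetI, rule UN_I[of 0]) auto

lemma generated_algebra_nor:
  assumes "A \<in> generated_algebra X G" "B \<in> generated_algebra X G"
  shows "X - (A \<union> B) \<in> generated_algebra X G"
proof -
  obtain m n where "A \<in> algebra_stage X G m" "B \<in> algebra_stage X G n"
    using assms unfolding generated_algebra_def by blast
  then have "A \<in> algebra_stage X G (max m n)" "B \<in> algebra_stage X G (max m n)"
    using algebra_stage_mono[of m "max m n" X G] algebra_stage_mono[of n "max m n" X G] by auto
  then have "X - (A \<union> B) \<in> algebra_stage X G (Suc (max m n))"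
    by auto
  then show ?thesis
    unfolding generated_algebra_def by blast
qed

lemma generated_algebra_subset_sigma:
  assumes G: "G \<subseteq> Pow X"
  shows "generated_algebra X G \<subseteq> sigma_sets X G"
proof -
  interpret sigma_algebra X "sigma_sets X G"
    using G by (rule sigma_algebra_sigma_sets)
  have "algebra_stage X G n \<subseteq> sigma_sets X G" for n
    by (induction n) auto
  then show ?thesis
    unfolding generated_algebra_def by blast
qed

lemma generated_algebra_compl:
  "A \<in> generated_algebra X G \<Longrightarrow> X - A \<in> generated_algebra X G"
  using generated_algebra_nor[of A X G A] by simp

lemma generated_algebra_Un:
  assumes "G \<subseteq> Pow X" "A \<in> generated_algebra X G" "B \<in> generated_algebra X G"
  shows "A \<union> B \<in> generated_algebra X G"
proof -
  have "A \<subseteq> X" "B \<subseteq> X"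
    using assms generated_algebra_subset_sigma[OF assms(1)] sigma_sets_into_sp[OF assms(1)] by auto
  then have "A \<union> B = X - (X - (A \<union> B))"
    by blast
  then show ?thesis
    using generated_algebra_compl[OF generated_algebra_nor[OF assms(2,3)]] by simp
qed

lemma finite_ordLeq_infinite:
  assumes "finite A" "infinite I"
  shows "|A| \<le>o |I|"
proof -
  have "|A| <o natLeq"
    using assms(1) by (simp add: finite_iff_ordLess_natLeq)
  moreover have "natLeq \<le>o |I|"
    using assms(2) infinite_iff_natLeq_ordLeq by blast
  ultimately show ?thesis
    by (rule ordLess_imp_ordLeq[OF ordLess_ordLeq_trans])
qed

text \<open>Each stage adds an image of the square of the previous one, which for an infinite bound stays
  within the bound, and there are only countably many stages.\<close>

lemma card_of_generated_algebra:
  fixes G :: "'a set set"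
  assumes inf: "infinite I" and G: "|G| \<le>o |I|"
  shows "|generated_algebra X G| \<le>o |I|"
proof -
  have Un: "|\<A> \<union> \<B>| \<le>o |I|" if "|\<A>| \<le>o |I|" "|\<B>| \<le>o |I|" for \<A> \<B> :: "'a set set"
    by (rule card_of_Un_ordLeq_infinite_Field[OF _ that card_of_Card_order])
      (simp add: inf Field_card_of)
  have "|algebra_stage X G n| \<le>o |I|" for n
  proof (induction n)
    case 0
    have "|{{}} \<union> G| \<le>o |I|"
      by (rule Un[OF finite_ordLeq_infinite[OF _ inf] G]) simp
    then show ?case by simp
  next
    case (Suc n)
    have "|algebra_stage X G n \<times> algebra_stage X G n| \<le>o |I|"
      using inf Suc by (intro card_of_Sigma_ordLeq_infinite) auto
    from Un[OF Suc ordLeq_transitive[OF card_of_image this]] show ?case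
      unfolding algebra_stage.simps .
  qed
  moreover have "|UNIV :: nat set| \<le>o |I|"
    using inf infinite_iff_card_of_nat by blast
  ultimately show ?thesis
    unfolding generated_algebra_def using inf by (intro card_of_UNION_ordLeq_infinite) auto
qed

section \<open>Approximation in measure\<close>

definition approximable :: "'a measure \<Rightarrow> 'a set set \<Rightarrow> 'a set \<Rightarrow> bool" where
  "approximable M H A \<longleftrightarrow> (\<forall>\<delta>>0. \<exists>C\<in>H. measure M ((A - C) \<union> (C - A)) < \<delta>)"

text \<open>Errors add up under unions, so finite unions inherit approximability; a countable union
  differs from its finite partial unions by a set of small measure.\<close>

lemma (in finite_measure) approximable_Un:
  assumes H: "H \<subseteq> sets M" "\<And>C D. C \<in> H \<Longrightarrow> D \<in> H \<Longrightarrow> C \<union> D \<in> H"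
    and A: "A \<in> sets M" "approximable M H A" and B: "B \<in> sets M" "approximable M H B"
  shows "approximable M H (A \<union> B)"
  unfolding approximable_def
proof (intro allI impI)
  fix \<delta> :: real assume "\<delta> > 0"
  then have "\<delta> / 2 > 0" by simp
  then obtain C D where C: "C \<in> H" "measure M ((A - C) \<union> (C - A)) < \<delta> / 2"
    and D: "D \<in> H" "measure M ((B - D) \<union> (D - B)) < \<delta> / 2"
    using A(2) B(2) unfolding approximable_def by meson
  have CD: "C \<in> sets M" "D \<in> sets M"
    using C D H by auto
  have "measure M (((A \<union> B) - (C \<union> D)) \<union> ((C \<union> D) - (A \<union> B)))
      \<le> measure M (((A - C) \<union> (C - A)) \<union> ((B - D) \<union> (D - B)))"
    using A B CD by (intro finite_measure_mono) auto
  also have "\<dots> \<le> measure M ((A - C) \<union> (C - A)) + measure M ((B - D) \<union> (D - B))"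
    using A B CD by (intro measure_Un_le) auto
  also have "\<dots> < \<delta>"
    using C D by simp
  finally show "\<exists>E\<in>H. measure M (((A \<union> B) - E) \<union> (E - (A \<union> B))) < \<delta>"
    using C D H by blast
qed

lemma (in finite_measure) approximable_UN:
  fixes A :: "nat \<Rightarrow> 'a set"
  assumes H: "H \<subseteq> sets M" "{} \<in> H" "\<And>C D. C \<in> H \<Longrightarrow> D \<in> H \<Longrightarrow> C \<union> D \<in> H"
    and A: "\<And>i. A i \<in> sets M" "\<And>i. approximable M H (A i)"
  shows "approximable M H (\<Union>i. A i)"
  unfolding approximable_def
proof (intro allI impI)
  fix \<delta> :: real assume \<delta>: "\<delta> > 0"
  define U where "U N = (\<Union>i<N. A i)" for N
  have U: "U N \<in> sets M" for N
    unfolding U_def using A by auto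
  have "approximable M H (U N)" for N
  proof (induction N)
    case 0
    show ?case
      unfolding approximable_def using H(2) by (auto simp: U_def intro!: bexI[of _ "{}"])
  next
    case (Suc N)
    have "U (Suc N) = U N \<union> A N"
      unfolding U_def by (auto simp: less_Suc_eq)
    then show ?case
      using approximable_Un[OF H(1,3) U Suc A] by simp
  qed
  note approx_U = this
  have UN: "(\<Union>N. U N) = (\<Union>i. A i)"
    unfolding U_def by blast
  have "incseq U"
    unfolding incseq_def U_def by (intro allI impI UN_mono) auto
  then have "(\<lambda>N. measure M (U N)) \<longlonglongrightarrow> measure M (\<Union>N. U N)"
    using U by (intro finite_Lim_measure_incseq) auto
  then have "(\<lambda>N. measure M (U N)) \<longlonglongrightarrow> measure M (\<Union>i. A i)"
    unfolding UN .
  then have "eventually (\<lambda>N. measure M (U N) > measure M (\<Union>i. A i) - \<delta> / 2) sequentially"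
    using \<delta> by (intro order_tendstoD) auto
  then obtain N where N: "measure M (U N) > measure M (\<Union>i. A i) - \<delta> / 2"
    by (auto simp: eventually_sequentially)
  have tail: "measure M ((\<Union>i. A i) - U N) < \<delta> / 2"
    using N U A by (subst finite_measure_Diff) (auto simp: U_def)
  obtain C where C: "C \<in> H" "measure M ((U N - C) \<union> (C - U N)) < \<delta> / 2"
    using approx_U[of N] \<delta> unfolding approximable_def by (meson half_gt_zero)
  have C': "C \<in> sets M"
    using C H by auto
  have UA: "U N \<subseteq> (\<Union>i. A i)"
    by (auto simp: U_def)
  have "measure M (((\<Union>i. A i) - C) \<union> (C - (\<Union>i. A i)))
      \<le> measure M (((\<Union>i. A i) - U N) \<union> ((U N - C) \<union> (C - U N)))"
    using U A C' UA by (intro finite_measure_mono) blast+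
  also have "\<dots> \<le> measure M ((\<Union>i. A i) - U N) + measure M ((U N - C) \<union> (C - U N))"
    using U A C' by (intro measure_Un_le) auto
  also have "\<dots> < \<delta>"
    using tail C by simp
  finally show "\<exists>E\<in>H. measure M (((\<Union>i. A i) - E) \<union> (E - (\<Union>i. A i))) < \<delta>"
    using C by blast
qed

lemma (in finite_measure) approximable_by_algebra:
  assumes G: "G \<subseteq> Pow (space M)" "sets M = sigma_sets (space M) G" and A: "A \<in> sets M"
  shows "approximable M (generated_algebra (space M) G) A"
proof -
  let ?H = "generated_algebra (space M) G"
  have H: "?H \<subseteq> sets M"
    using generated_algebra_subset_sigma[OF G(1)] unfolding G(2) .
  from A[unfolded G(2)] show ?thesis
  proof (induction rule: sigma_sets.induct)
    case (Basic A)
    then have "A \<in> ?H"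
      using generated_algebra_base by blast
    then show ?case
      unfolding approximable_def by (auto intro!: bexI[of _ A])
  next
    case Empty
    show ?case
      unfolding approximable_def
      by (auto intro!: bexI[of _ "{}"] simp: generated_algebra_empty)
  next
    case (Compl A)
    show ?case
      unfolding approximable_def
    proof (intro allI impI)
      fix \<delta> :: real assume "\<delta> > 0"
      then obtain C where C: "C \<in> ?H" "measure M ((A - C) \<union> (C - A)) < \<delta>"
        using Compl unfolding approximable_def by blast
      have "A \<subseteq> space M" "C \<subseteq> space M"
        using Compl(1) C(1) H G(2) sets.sets_into_space by blast+
      then have "(space M - A - (space M - C)) \<union> (space M - C - (space M - A)) = (A - C) \<union> (C - A)"
        by blast
      then show "\<exists>C\<in>?H. measure M ((space M - A - C) \<union> (C - (space M - A))) < \<delta>"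
        using C generated_algebra_compl by (intro bexI[of _ "space M - C"]) auto
    qed
  next
    case (Union A)
    show ?case
      using Union G(2)
      by (intro approximable_UN H generated_algebra_empty generated_algebra_Un[OF G(1)]) auto
  qed
qed

text \<open>With error below \<open>\<epsilon>/2\<close> times the measure of \<open>A\<close>, the approximating set \<open>C\<close> has at least half
  the measure of \<open>A\<close>, so the part of \<open>C\<close> outside \<open>A\<close> is at most the fraction \<open>\<epsilon>\<close> of \<open>C\<close>.\<close>

lemma (in finite_measure) algebra_member_mostly_filled:
  assumes H: "H \<subseteq> sets M" and A: "A \<in> sets M" "approximable M H A" "measure M A > 0"
    and \<epsilon>: "0 < \<epsilon>" "\<epsilon> < 1"
  obtains C where "C \<in> H" "measure M C > 0" "(1 - \<epsilon>) * measure M C \<le> measure M (A \<inter> C)"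
proof -
  have "\<epsilon> * measure M A / 2 > 0"
    using A(3) \<epsilon> by simp
  then obtain C where C: "C \<in> H" "measure M ((A - C) \<union> (C - A)) < \<epsilon> * measure M A / 2"
    using A(2) unfolding approximable_def by blast
  have C': "C \<in> sets M"
    using C H by auto
  have "measure M (A - C) \<le> measure M ((A - C) \<union> (C - A))"
    "measure M (C - A) \<le> measure M ((A - C) \<union> (C - A))"
    using A C' by (auto intro!: finite_measure_mono)
  then have out: "measure M (A - C) < \<epsilon> * measure M A / 2" "measure M (C - A) < \<epsilon> * measure M A / 2"
    using C(2) by auto
  have split: "measure M A = measure M (A - C) + measure M (A \<inter> C)"
    "measure M C = measure M (C - A) + measure M (A \<inter> C)"
    using A C' finite_measure_Diff'[of A C] finite_measure_Diff'[of C A] by (auto simp: Int_commute)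
  have "\<epsilon> * measure M A \<le> measure M A"
    using \<epsilon> A(3) by (simp add: mult_le_cancel_right1)
  then have half: "measure M A / 2 < measure M C"
    using out(1) split measure_nonneg[of M "C - A"] by linarith
  then have "\<epsilon> * (measure M A / 2) \<le> \<epsilon> * measure M C"
    using \<epsilon> by (intro mult_left_mono) auto
  then have "(1 - \<epsilon>) * measure M C \<le> measure M (A \<inter> C)"
    using out(2) split(2) by (simp add: algebra_simps)
  moreover have "measure M C > 0"
    using half A(3) by linarith
  ultimately show ?thesis
    using C(1) that by blast
qed

section \<open>Averaging\<close>

text \<open>Almost every point of \<open>C\<close> lies in at most \<open>k\<close> of the sets: otherwise, there being finitely many
  subfamilies, one with more than \<open>k\<close> members would have an intersection of positive measure inside
  \<open>C\<close>. Integrating over \<open>C\<close> the number of sets that contain a point gives the bound.\<close>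

lemma (in finite_measure) sum_measure_le_overlap:
  fixes n k :: nat
  assumes A: "\<And>i. i < n \<Longrightarrow> A i \<in> sets M" and C: "C \<in> sets M"
    and k: "\<And>F. F \<subseteq> {..<n} \<Longrightarrow> measure M (C \<inter> (\<Inter>i\<in>F. A i)) > 0 \<Longrightarrow> card F \<le> k"
  shows "(\<Sum>i<n. measure M (A i \<inter> C)) \<le> real k * measure M C"
proof -
  have meas: "C \<inter> (\<Inter>i\<in>F. A i) \<in> sets M" if "F \<subseteq> {..<n}" for F
  proof (cases "F = {}")
    case False
    moreover have "finite F"
      using finite_subset[OF that] by simp
    ultimately have "(\<Inter>i\<in>F. A i) \<in> sets M"
      using that A False by (intro sets.finite_INT) auto
    with C show ?thesis
      by (rule sets.Int)
  qed (use C in simp)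
  have "AE x in M. \<forall>F\<in>{F. F \<subseteq> {..<n} \<and> k < card F}. x \<notin> C \<inter> (\<Inter>i\<in>F. A i)"
  proof (rule AE_finite_allI)
    fix F assume F: "F \<in> {F. F \<subseteq> {..<n} \<and> k < card F}"
    then have "measure M (C \<inter> (\<Inter>i\<in>F. A i)) = 0"
      using k[of F] by (auto simp: zero_less_measure_iff)
    then have "C \<inter> (\<Inter>i\<in>F. A i) \<in> null_sets M"
      using F meas[of F] by (auto simp: null_sets_def emeasure_eq_measure)
    then show "AE x in M. x \<notin> C \<inter> (\<Inter>i\<in>F. A i)"
      by (rule AE_not_in)
  qed simp
  then have ae: "AE x in M. (\<Sum>i<n. indicator (A i \<inter> C) x) \<le> real k * indicator C x"
  proof eventually_elim
    case (elim x)
    show ?case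
    proof (cases "x \<in> C")
      case True
      have "x \<in> C \<inter> (\<Inter>i\<in>{i\<in>{..<n}. x \<in> A i}. A i)"
        using True by auto
      with elim have "\<not> k < card {i\<in>{..<n}. x \<in> A i}"
        by blast
      moreover have "(\<Sum>i<n. indicator (A i \<inter> C) x) = real (card {i\<in>{..<n}. x \<in> A i})"
        using True by (simp add: indicator_def sum.If_cases Int_def)
      ultimately show ?thesis
        using True by simp
    qed simp
  qed
  have int: "integrable M (indicator (A i \<inter> C) :: _ \<Rightarrow> real)" if "i < n" for i
    using A[OF that] C by (intro integrable_real_indicator) (auto simp: less_top[symmetric])
  have intC: "integrable M (indicator C :: _ \<Rightarrow> real)"
    using C by (intro integrable_real_indicator) (auto simp: less_top[symmetric])
  have "(\<Sum>i<n. measure M (A i \<inter> C)) = (\<integral>x. (\<Sum>i<n. indicator (A i \<inter> C) x) \<partial>M)"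
    using int A C by (subst Bochner_Integration.integral_sum) (auto intro!: sum.cong)
  also have "\<dots> \<le> (\<integral>x. real k * indicator C x \<partial>M)"
    using int intC ae by (intro integral_mono_AE) auto
  also have "\<dots> = real k * measure M C"
    using C by simp
  finally show ?thesis .
qed

section \<open>Intersection-linkedness of measure algebras\<close>

text \<open>The zero class consists of the null sets, so the conditions are the classes of the sets of
  positive measure, ordered by inclusion up to a null set.\<close>

lemma (in finite_measure) quotient_forcing:
  defines "P \<equiv> forcing_of (quotient_algebra (sets M) (null_sets M))"
    and "cls \<equiv> \<lambda>A. mod_ideal (sets M) (null_sets M) `` {A}"
  shows carrier_quotient_forcing: "carrier P = cls ` {A \<in> sets M. measure M A > 0}"
    and le_quotient_forcing:
      "\<And>A B. A \<in> sets M \<Longrightarrow> B \<in> sets M \<Longrightarrow> cls A \<sqsubseteq>\<^bsub>P\<^esub> cls B \<longleftrightarrow> A - B \<in> null_sets M"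
proof -
  let ?L = "quotient_algebra (sets M) (null_sets M)"
  have "cls A = null_sets M \<longleftrightarrow> measure M A = 0" if A: "A \<in> sets M" for A
  proof
    assume "cls A = null_sets M"
    moreover have "A \<in> cls A"
      using A by (simp add: cls_def mod_ideal_def)
    ultimately show "measure M A = 0"
      by (simp add: null_sets_def measure_def)
  next
    assume "measure M A = 0"
    then have null: "A \<in> null_sets M"
      using A by (simp add: null_sets_def emeasure_eq_measure)
    have "B \<in> cls A \<longleftrightarrow> B \<in> null_sets M" for B
    proof
      assume "B \<in> cls A"
      then have B: "B \<in> sets M" "(A - B) \<union> (B - A) \<in> null_sets M"
        by (auto simp: cls_def mod_ideal_def)
      show "B \<in> null_sets M"
        using null_sets_subset[OF null_sets.Un[OF B(2) null] B(1)] by blast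
    next
      assume B: "B \<in> null_sets M"
      have "(A - B) \<union> (B - A) \<in> null_sets M"
        by (rule null_sets_subset[OF null_sets.Un[OF null B]]) (use A B in auto)
      then show "B \<in> cls A"
        using A B by (auto simp: cls_def mod_ideal_def)
    qed
    then show "cls A = null_sets M"
      by blast
  qed
  then have zero: "cls A \<noteq> \<bottom>\<^bsub>?L\<^esub> \<longleftrightarrow> measure M A > 0" if "A \<in> sets M" for A
    using that measure_nonneg[of M A] unfolding quotient_algebra_order(4) by (simp add: less_le)
  have "carrier ?L = cls ` sets M"
    unfolding cls_def by (rule quotient_algebra_order(1))
  then show "carrier P = cls ` {A \<in> sets M. measure M A > 0}"
    using zero unfolding P_def forcing_of_def by auto
  show "cls A \<sqsubseteq>\<^bsub>P\<^esub> cls B \<longleftrightarrow> A - B \<in> null_sets M" if "A \<in> sets M" "B \<in> sets M" for A B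
    using quotient_algebra_order(2)[OF that] unfolding P_def cls_def forcing_of_def by simp
qed

lemma le_i_star:
  assumes "F \<subseteq> {..<n}" "Lower P (q ` F) \<noteq> {}"
  shows "card F \<le> i_star P n q"
  unfolding i_star_def
proof (rule Max_ge)
  show "finite {card F |F. F \<subseteq> {..<n} \<and> Lower P (q ` F) \<noteq> {}}"
    by (rule finite_surj[of "Pow {..<n}" _ card]) auto
qed (use assms in blast)

text \<open>A null set \<open>C\<close> is filled to any fraction by every set, the null sets included; the
  requirement of positive measure makes the family empty in that case.\<close>

definition filling_classes :: "'a measure \<Rightarrow> 'a set \<Rightarrow> real \<Rightarrow> 'a set set set" where
  "filling_classes M C \<epsilon> = (\<lambda>A. mod_ideal (sets M) (null_sets M) `` {A}) `
     {A \<in> sets M. measure M C > 0 \<and> (1 - \<epsilon>) * measure M C \<le> measure M (A \<inter> C)}"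

lemma (in finite_measure) filling_classes_subset_carrier:
  assumes "C \<in> sets M" "\<epsilon> < 1"
  shows "filling_classes M C \<epsilon> \<subseteq> carrier (forcing_of (quotient_algebra (sets M) (null_sets M)))"
proof -
  have "measure M A > 0"
    if "A \<in> sets M" "measure M C > 0" "(1 - \<epsilon>) * measure M C \<le> measure M (A \<inter> C)" for A
  proof -
    have "0 < (1 - \<epsilon>) * measure M C"
      using that assms by simp
    also have "\<dots> \<le> measure M A"
      using that assms finite_measure_mono[of "A \<inter> C" A] by auto
    finally show ?thesis .
  qed
  then show ?thesis
    unfolding filling_classes_def carrier_quotient_forcing by blast
qed

text \<open>For \<open>n\<close> members the measures inside \<open>C\<close> add up to at least \<open>n(1 - \<epsilon>)\<close> times the measure of
  \<open>C\<close>. By averaging they add up to at most \<open>i\<^sub>*\<close> times the measure of \<open>C\<close>, as any subfamily whose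
  common part inside \<open>C\<close> is not null has the class of that part as a lower bound.\<close>

lemma (in finite_measure) int_number_filling_classes:
  assumes C: "C \<in> sets M"
  shows "int_number (forcing_of (quotient_algebra (sets M) (null_sets M))) (filling_classes M C \<epsilon>)
    \<ge> ereal (1 - \<epsilon>)"
  unfolding int_number_def
proof (rule Inf_greatest)
  let ?P = "forcing_of (quotient_algebra (sets M) (null_sets M))"
  let ?cls = "\<lambda>A. mod_ideal (sets M) (null_sets M) `` {A}"
  fix r assume "r \<in> {ereal (real (i_star ?P n q) / real n) |n q.
    n \<noteq> 0 \<and> q \<in> {..<n} \<rightarrow>\<^sub>E filling_classes M C \<epsilon>}"
  then obtain n q where r: "r = ereal (real (i_star ?P n q) / real n)"
    and n: "n \<noteq> 0" and q: "\<And>i. i < n \<Longrightarrow> q i \<in> filling_classes M C \<epsilon>"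
    by auto
  then have "\<forall>i\<in>{..<n}. \<exists>A. A \<in> sets M \<and> q i = ?cls A \<and> measure M C > 0 \<and>
      (1 - \<epsilon>) * measure M C \<le> measure M (A \<inter> C)"
    unfolding filling_classes_def by blast
  then obtain A where A: "\<And>i. i < n \<Longrightarrow> A i \<in> sets M" "\<And>i. i < n \<Longrightarrow> q i = ?cls (A i)"
    "\<And>i. i < n \<Longrightarrow> (1 - \<epsilon>) * measure M C \<le> measure M (A i \<inter> C)"
    and "\<And>i. i < n \<Longrightarrow> measure M C > 0"
    by (auto dest!: bchoice)
  with n have pos: "measure M C > 0"
    by blast
  have "(\<Sum>i<n. measure M (A i \<inter> C)) \<le> real (i_star ?P n q) * measure M C"
  proof (rule sum_measure_le_overlap[OF A(1) C])
    fix F assume F: "F \<subseteq> {..<n}" and B: "measure M (C \<inter> (\<Inter>i\<in>F. A i)) > 0"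
    let ?B = "C \<inter> (\<Inter>i\<in>F. A i)"
    have meas: "?B \<in> sets M"
      using B measure_notin_sets by fastforce
    have "?cls ?B \<in> Lower ?P (q ` F)"
      unfolding Lower_def
    proof (intro IntI CollectI allI impI)
      show "?cls ?B \<in> carrier ?P"
        unfolding carrier_quotient_forcing using B meas by blast
      fix x assume "x \<in> q ` F \<inter> carrier ?P"
      then obtain i where i: "i \<in> F" "x = ?cls (A i)" "i < n"
        using F A(2) by auto
      have "?B - A i = {}"
        using i by blast
      then have "?B - A i \<in> null_sets M"
        by (simp only: null_sets.empty_sets)
      then show "?cls ?B \<sqsubseteq>\<^bsub>?P\<^esub> x"
        unfolding i(2) using le_quotient_forcing[OF meas A(1)[OF i(3)]] by blast
    qed
    then show "card F \<le> i_star ?P n q"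
      using F by (intro le_i_star) auto
  qed
  moreover have "real n * ((1 - \<epsilon>) * measure M C) \<le> (\<Sum>i<n. measure M (A i \<inter> C))"
    using sum_mono[of "{..<n}" "\<lambda>_. (1 - \<epsilon>) * measure M C" "\<lambda>i. measure M (A i \<inter> C)"] A(3) by simp
  ultimately have "(real n * (1 - \<epsilon>)) * measure M C \<le> real (i_star ?P n q) * measure M C"
    by (simp add: mult.assoc)
  then have "real n * (1 - \<epsilon>) \<le> real (i_star ?P n q)"
    using pos by simp
  then show "ereal (1 - \<epsilon>) \<le> r"
    unfolding r using n by (simp add: field_simps)
qed

text \<open>The families are indexed through an enumeration of the generated algebra along \<open>\<theta>\<close>: the
  number of generators is all that the size of the index set has to match.\<close>

theorem (in finite_measure) intersection_linked_quotient_algebra: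
  assumes \<theta>: "Cinfinite \<theta>"
    and G: "G \<subseteq> Pow (space M)" "sets M = sigma_sets (space M) G" "|G| \<le>o |Field \<theta>|"
  shows "intersection_linked \<theta> (forcing_of (quotient_algebra (sets M) (null_sets M)))"
proof -
  let ?P = "forcing_of (quotient_algebra (sets M) (null_sets M))"
  let ?H = "generated_algebra (space M) G"
  have H: "?H \<subseteq> sets M"
    using generated_algebra_subset_sigma[OF G(1)] unfolding G(2) .
  have "infinite (Field \<theta>)"
    using \<theta> by (simp add: cinfinite_def)
  then have "|?H| \<le>o |Field \<theta>|"
    using G(3) by (rule card_of_generated_algebra)
  then obtain g where g: "g ` Field \<theta> = ?H"
    using card_of_ordLeq2[of ?H "Field \<theta>"] generated_algebra_empty by blast
  define Q where "Q \<alpha> \<epsilon> = filling_classes M (g \<alpha>) (real_of_rat \<epsilon>)" for \<alpha> and \<epsilon> :: rat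
  have gM: "g \<alpha> \<in> sets M" if "\<alpha> \<in> Field \<theta>" for \<alpha>
    using that g H by blast
  have sub: "Q \<alpha> \<epsilon> \<subseteq> carrier ?P" if "\<alpha> \<in> Field \<theta>" "\<epsilon> \<in> {0<..<1}" for \<alpha> \<epsilon>
    unfolding Q_def using that gM by (intro filling_classes_subset_carrier) auto
  have int: "int_number ?P (Q \<alpha> \<epsilon>) \<ge> ereal (1 - real_of_rat \<epsilon>)" if "\<alpha> \<in> Field \<theta>" for \<alpha> \<epsilon>
    unfolding Q_def using that gM by (intro int_number_filling_classes) auto
  have dense: "dense_in ?P (\<Union>\<alpha>\<in>Field \<theta>. Q \<alpha> \<epsilon>)" if \<epsilon>: "\<epsilon> \<in> {0<..<1}" for \<epsilon>
    unfolding dense_in_def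
  proof (intro conjI ballI)
    show "(\<Union>\<alpha>\<in>Field \<theta>. Q \<alpha> \<epsilon>) \<subseteq> carrier ?P"
      using sub \<epsilon> by blast
    fix p assume "p \<in> carrier ?P"
    then obtain A where A: "A \<in> sets M" "measure M A > 0"
      and p: "p = mod_ideal (sets M) (null_sets M) `` {A}"
      unfolding carrier_quotient_forcing by blast
    obtain C where C: "C \<in> ?H" "measure M C > 0"
      "(1 - real_of_rat \<epsilon>) * measure M C \<le> measure M (A \<inter> C)"
      using \<epsilon> A algebra_member_mostly_filled[OF H A(1) approximable_by_algebra[OF G(1,2) A(1)],
          of "real_of_rat \<epsilon>"] by auto
    obtain \<alpha> where "\<alpha> \<in> Field \<theta>" "C = g \<alpha>"
      using C(1) g by blast
    \<comment> \<open>The families exhaust the forcing, so \<open>p\<close> itself is the required extension of \<open>p\<close>.\<close>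
    then have "p \<in> (\<Union>\<alpha>\<in>Field \<theta>. Q \<alpha> \<epsilon>)"
      unfolding Q_def filling_classes_def p using A(1) C by blast
    moreover have "p \<sqsubseteq>\<^bsub>?P\<^esub> p"
      unfolding p using A(1) by (simp add: le_quotient_forcing)
    ultimately show "\<exists>d\<in>\<Union>\<alpha>\<in>Field \<theta>. Q \<alpha> \<epsilon>. d \<sqsubseteq>\<^bsub>?P\<^esub> p"
      by blast
  qed
  show ?thesis
    unfolding intersection_linked_def using sub int dense by (intro exI[of _ Q]) blast
qed

section \<open>The algebras adding random reals\<close>

lemma prob_space_Leb: "prob_space (Leb I)"
  unfolding Leb_def by (intro prob_space_PiM prob_space_uniform_count_measure) auto

lemma intersection_linked_measure_algebra:
  fixes \<theta> :: "'i rel"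
  assumes \<theta>: "Cinfinite \<theta>"
  shows "intersection_linked \<theta> (forcing_of (measure_algebra (Field \<theta>)))"
proof -
  let ?I = "Field \<theta>"
  interpret prob_space "Leb ?I"
    by (rule prob_space_Leb)
  define S where "S = (\<lambda>(i, B). {f \<in> ?I \<rightarrow>\<^sub>E (UNIV :: bool set). f i \<in> B})"
  define G where "G = S ` (?I \<times> UNIV)"
  have inf: "infinite ?I"
    using \<theta> by (simp add: cinfinite_def)
  have gen: "G = {{f \<in> ?I \<rightarrow>\<^sub>E UNIV. f i \<in> B} | i B. i \<in> ?I \<and> B \<in> UNIV}"
    unfolding G_def S_def by auto
  have "sets (Leb ?I) = sigma_sets (?I \<rightarrow>\<^sub>E UNIV) G"
    unfolding gen Leb_def
    by (subst sets_PiM_single) (simp add: space_uniform_count_measure sets_uniform_count_measure)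
  then have sets: "sets (Leb ?I) = sigma_sets (space (Leb ?I)) G"
    by (simp add: space_Leb)
  have "|?I \<times> (UNIV :: bool set set)| \<le>o |?I|"
  proof (rule card_of_Sigma_ordLeq_infinite[OF inf _ ballI])
    show "|?I| \<le>o |?I|"
      by (rule card_of_mono1) simp
    show "|UNIV :: bool set set| \<le>o |?I|"
      using inf by (intro finite_ordLeq_infinite) auto
  qed
  then have card: "|G| \<le>o |?I|"
    unfolding G_def by (rule ordLeq_transitive[OF card_of_image])
  have "G \<subseteq> Pow (space (Leb ?I))"
    unfolding gen space_Leb by blast
  then show ?thesis
    unfolding measure_algebra_eq
    using intersection_linked_quotient_algebra[OF \<theta> _ sets card] by blast
qed

theorem corollary4p11:
  shows "(\<forall>\<theta> :: 'i rel. Cinfinite \<theta> \<longrightarrow>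
            intersection_linked \<theta> (forcing_of (measure_algebra (Field \<theta>)))) \<and>
         sigma_intersection_linked (forcing_of random_algebra)"
proof (intro conjI allI impI)
  fix \<theta> :: "'i rel"
  assume "Cinfinite \<theta>"
  then show "intersection_linked \<theta> (forcing_of (measure_algebra (Field \<theta>)))"
    by (rule intersection_linked_measure_algebra)
next
  have "random_algebra = measure_algebra (Field natLeq)"
    by (simp add: random_algebra_eq measure_algebra_eq Field_natLeq)
  then show "sigma_intersection_linked (forcing_of random_algebra)"
    using intersection_linked_measure_algebra[OF natLeq_Cinfinite] by simp
qed

end
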